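(* Let $\lVert\cdot\rVert_A$ and $\lVert\cdot\rVert_B$ be rearrangement-invariant Banach function norms over $([0,\infty),\lambda)$. Then the Wiener--Luxemburg quasinorm $\lVert\cdot\rVert_{WL(A,B)}$ is a rearrangement-invariant quasi-Banach function norm, and it also satisfies axiom (P5) of Banach function norms. Consequently, the Wiener--Luxemburg amalgam space $WL(A,B)$ is a rearrangement-invariant quasi-Banach function space.
   Context: $\lambda$ is Lebesgue measure on $[0,\infty)$; $M$ is the set of extended complex-valued $\lambda$-measurable functions on $[0,\infty)$ (identified when equal a.e.), $M_+$ the non-negative ones. The non-increasing rearrangement of $f\in M$ is $f^*(t)=\inf\{s\ge 0:\lambda(\{|f|>s\})\le t\}$, $t\in[0,\infty)$. Two functions are equimeasurable if $\lambda(\{|f|>s\})=\lambda(\{|g|>s\})$ for all $s\ge0$ (equivalently $f^*=g^*$). A Banach function norm is a map $\lVert\cdot\rVert:M\to[0,\infty]$ with $\lVert\,|f|\,\rVert=\lVert f\rVert$ whose restriction to $M_+$ satisfies: (P1) it is positively homogeneous, $\lVert f\rVert=0\Leftrightarrow f=0$ a.e., and $\lVert f+g\rVert\le\lVert f\rVert+\lVert g\rVert$; (P2) $f\le g$ a.e. implies $\lVert f\rVert\le\lVert g\rVert$; (P3) $f_n\uparrow f$ a.e. implies $\lVert f_n\rVert\uparrow\lVert f\rVert$; (P4) $\lVert\chi_E\rVert<\infty$ whenever $\lambda(E)<\infty$; (P5) for every $E$ with $\lambda(E)<\infty$ there is a finite constant $C_E$ with $\int_E f\,d\lambda\le C_E\lVert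 f\rVert$ for all $f\in M_+$. A quasi-Banach function norm is such a map satisfying (P2), (P3), (P4) and (Q1): the same as (P1) but with the triangle inequality replaced by $\lVert f+g\rVert\le C(\lVert f\rVert+\lVert g\rVert)$ for some constant $C\ge1$. The corresponding (quasi-)Banach function space is $X=\{f\in M:\lVert f\rVert_X<\infty\}$. Rearrangement-invariant (r.i.) means $\lVert f\rVert=\lVert g\rVert$ for equimeasurable $f,g$; the space is then also called rearrangement-invariant. For r.i. Banach function norms $\lVert\cdot\rVert_A,\lVert\cdot\rVert_B$: $\lVert f\rVert_{WL(A,B)}=\lVert f^*\chi_{[0,1]}\rVert_A+\lVert f^*\chi_{(1,\infty)}\rVert_B$ for $f\in M$, and $WL(A,B)=\{f\in M:\lVert f\rVert_{WL(A,B)}<\infty\}$. *)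

theory Defs
  imports "HOL-Analysis.Analysis"
begin

abbreviation halfline :: "real measure" (\<open>\<lambda>\<^sub>+\<close>) where
  "\<lambda>\<^sub>+ \<equiv> lebesgue_on {0..}"

text \<open>
  The extended complex numbers are the one-point compactification of the complex plane,
  with \<^const>\<open>None\<close> as the point at infinity; the sigma-algebra is the Borel one.
\<close>

type_synonym ecomplex = "complex option"

definition ecomplex_borel :: "ecomplex measure" where
  "ecomplex_borel =
     sigma UNIV {U. openin (Alexandroff_compactification (euclidean :: complex topology)) U}"

definition ecmod :: "ecomplex \<Rightarrow> ennreal" where
  "ecmod z = (case z of None \<Rightarrow> \<infinity> | Some w \<Rightarrow> ennreal (cmod w))"

definition of_ennreal :: "ennreal \<Rightarrow> ecomplex" where
  "of_ennreal x = (if x = \<infinity> then None else Some (complex_of_real (enn2real x)))"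

text \<open>
  Almost-everywhere equal functions are not literally identified: elements of \<open>M\<close> and \<open>M\<^sub>+\<close> are
  represented by functions on the reals, whose values at negative arguments are irrelevant.
  Conditions (P2) and \<open>\<parallel>|f|\<parallel> = \<parallel>f\<parallel>\<close> below force the norms to respect almost-everywhere equality.
\<close>

definition M :: "(real \<Rightarrow> ecomplex) set" where
  "M = measurable \<lambda>\<^sub>+ ecomplex_borel"

definition Mplus :: "(real \<Rightarrow> ennreal) set" where
  "Mplus = borel_measurable \<lambda>\<^sub>+"

type_synonym fnorm = "(real \<Rightarrow> ecomplex) \<Rightarrow> ennreal"

definition on_nonneg :: "fnorm \<Rightarrow> (real \<Rightarrow> ennreal) \<Rightarrow> ennreal" where
  "on_nonneg N f = N (\<lambda>x. of_ennreal (f x))"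

definition distr_fun :: "(real \<Rightarrow> ecomplex) \<Rightarrow> real \<Rightarrow> ennreal" where
  "distr_fun f s = emeasure \<lambda>\<^sub>+ {x \<in> space \<lambda>\<^sub>+. ecmod (f x) > ennreal s}"

text \<open>The infimum is taken in the extended half-line, so that the empty set has infimum \<open>\<infinity>\<close>.\<close>

definition rearrangement :: "(real \<Rightarrow> ecomplex) \<Rightarrow> real \<Rightarrow> ennreal" where
  "rearrangement f t = Inf {ennreal s | s. s \<ge> 0 \<and> distr_fun f s \<le> ennreal t}"

definition equimeasurable :: "(real \<Rightarrow> ecomplex) \<Rightarrow> (real \<Rightarrow> ecomplex) \<Rightarrow> bool" where
  "equimeasurable f g \<longleftrightarrow> (\<forall>s\<ge>0. distr_fun f s = distr_fun g s)"

definition modulus_invariant :: "fnorm \<Rightarrow> bool" where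
  "modulus_invariant N \<longleftrightarrow> (\<forall>f\<in>M. on_nonneg N (\<lambda>x. ecmod (f x)) = N f)"

definition pos_homogeneous :: "fnorm \<Rightarrow> bool" where
  "pos_homogeneous N \<longleftrightarrow>
     (\<forall>a\<ge>0. \<forall>f\<in>Mplus. on_nonneg N (\<lambda>x. ennreal a * f x) = ennreal a * on_nonneg N f)"

definition definite :: "fnorm \<Rightarrow> bool" where
  "definite N \<longleftrightarrow> (\<forall>f\<in>Mplus. on_nonneg N f = 0 \<longleftrightarrow> (AE x in \<lambda>\<^sub>+. f x = 0))"

definition axiom_P1 :: "fnorm \<Rightarrow> bool" where
  "axiom_P1 N \<longleftrightarrow> pos_homogeneous N \<and> definite N \<and>
     (\<forall>f\<in>Mplus. \<forall>g\<in>Mplus. on_nonneg N (\<lambda>x. f x + g x) \<le> on_nonneg N f + on_nonneg N g)"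

definition axiom_Q1 :: "fnorm \<Rightarrow> bool" where
  "axiom_Q1 N \<longleftrightarrow> pos_homogeneous N \<and> definite N \<and>
     (\<exists>C::real. C \<ge> 1 \<and> (\<forall>f\<in>Mplus. \<forall>g\<in>Mplus.
        on_nonneg N (\<lambda>x. f x + g x) \<le> ennreal C * (on_nonneg N f + on_nonneg N g)))"

definition axiom_P2 :: "fnorm \<Rightarrow> bool" where
  "axiom_P2 N \<longleftrightarrow> (\<forall>f\<in>Mplus. \<forall>g\<in>Mplus.
     (AE x in \<lambda>\<^sub>+. f x \<le> g x) \<longrightarrow> on_nonneg N f \<le> on_nonneg N g)"

definition axiom_P3 :: "fnorm \<Rightarrow> bool" where
  "axiom_P3 N \<longleftrightarrow> (\<forall>(F :: nat \<Rightarrow> real \<Rightarrow> ennreal) f. (\<forall>n. F n \<in> Mplus) \<longrightarrow> f \<in> Mplus \<longrightarrow>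
     (AE x in \<lambda>\<^sub>+. incseq (\<lambda>n. F n x) \<and> (\<lambda>n. F n x) \<longlonglongrightarrow> f x) \<longrightarrow>
     incseq (\<lambda>n. on_nonneg N (F n)) \<and> (\<lambda>n. on_nonneg N (F n)) \<longlonglongrightarrow> on_nonneg N f)"

definition axiom_P4 :: "fnorm \<Rightarrow> bool" where
  "axiom_P4 N \<longleftrightarrow> (\<forall>E\<in>sets \<lambda>\<^sub>+. emeasure \<lambda>\<^sub>+ E < \<infinity> \<longrightarrow> on_nonneg N (indicator E) < \<infinity>)"

definition axiom_P5 :: "fnorm \<Rightarrow> bool" where
  "axiom_P5 N \<longleftrightarrow> (\<forall>E\<in>sets \<lambda>\<^sub>+. emeasure \<lambda>\<^sub>+ E < \<infinity> \<longrightarrow>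
     (\<exists>C::real. C \<ge> 0 \<and> (\<forall>f\<in>Mplus. (\<integral>\<^sup>+x\<in>E. f x \<partial>\<lambda>\<^sub>+) \<le> ennreal C * on_nonneg N f)))"

definition banach_function_norm :: "fnorm \<Rightarrow> bool" where
  "banach_function_norm N \<longleftrightarrow> modulus_invariant N \<and>
     axiom_P1 N \<and> axiom_P2 N \<and> axiom_P3 N \<and> axiom_P4 N \<and> axiom_P5 N"

definition quasi_banach_function_norm :: "fnorm \<Rightarrow> bool" where
  "quasi_banach_function_norm N \<longleftrightarrow> modulus_invariant N \<and>
     axiom_Q1 N \<and> axiom_P2 N \<and> axiom_P3 N \<and> axiom_P4 N"

definition rearrangement_invariant :: "fnorm \<Rightarrow> bool" where
  "rearrangement_invariant N \<longleftrightarrow> (\<forall>f\<in>M. \<forall>g\<in>M. equimeasurable f g \<longrightarrow> N f = N g)"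

definition ri_quasi_banach_function_space :: "(real \<Rightarrow> ecomplex) set \<Rightarrow> fnorm \<Rightarrow> bool" where
  "ri_quasi_banach_function_space X N \<longleftrightarrow>
     quasi_banach_function_norm N \<and> rearrangement_invariant N \<and> X = {f \<in> M. N f < \<infinity>}"

definition WL_norm :: "fnorm \<Rightarrow> fnorm \<Rightarrow> fnorm" where
  "WL_norm A B f = on_nonneg A (\<lambda>t. rearrangement f t * indicator {0..1} t)
                 + on_nonneg B (\<lambda>t. rearrangement f t * indicator {1<..} t)"

definition WL_space :: "fnorm \<Rightarrow> fnorm \<Rightarrow> (real \<Rightarrow> ecomplex) set" where
  "WL_space A B = {f \<in> M. WL_norm A B f < \<infinity>}"

end

theory Submission
  imports Defs
begin

text \<open>
  No boundedness of dilation operators is needed. Put \<open>a = f\<^sup>*(1)\<close>, \<open>b = g\<^sup>*(1)\<close>, \<open>h = f + g\<close> and cut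
  \<open>f = (f - a)\<^sub>+ + min f a\<close>, and likewise \<open>g\<close>. The excess \<open>(f - a)\<^sub>+\<close> lives on a set of measure at
  most 1 and its distribution is dominated by that of \<open>f\<^sup>* \<chi>\<^bsub>[0,1]\<^esub>\<close>; the truncation \<open>min f a\<close> is
  dominated in distribution by \<open>a \<chi>\<^bsub>[0,1]\<^esub> + f\<^sup>* \<chi>\<^bsub>(1,\<infinity>)\<^esub>\<close>; and \<open>a\<close> itself is controlled by the
  \<open>A\<close>-norm of \<open>f\<^sup>* \<chi>\<^bsub>[0,1]\<^esub> \<ge> a \<chi>\<^bsub>[0,1]\<^esub>\<close>. A rearrangement-invariant norm is monotone in the
  distribution function, so the \<open>A\<close>-part of \<open>h\<close> is estimated by the excesses plus \<open>a + b\<close>. The two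
  excesses together live on a set of measure at most 2, so \<open>h\<^sup>* \<chi>\<^bsub>(2,\<infinity>)\<^esub>\<close> is dominated by the sum of
  the truncations, while on \<open>(1,2]\<close> the bound \<open>h\<^sup>* \<le> h\<^sup>*(1)\<close> leads back to the \<open>A\<close>-part. The same
  cut of \<open>f\<close> at height \<open>a\<close> yields (P5).
\<close>

section \<open>Non-negative extended values inside the extended complex numbers\<close>

lemma ecmod_of_ennreal [simp]: "ecmod (of_ennreal x) = x"
  by (cases x) (auto simp: of_ennreal_def ecmod_def)

lemma of_ennreal_measurable: "of_ennreal \<in> measurable borel ecomplex_borel"
  unfolding ecomplex_borel_def
proof (rule measurable_measure_of)
  have vimage_Some: "of_ennreal -` (Some ` V) \<in> sets borel" if "V \<in> sets borel" for V
  proof -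
    have "of_ennreal -` (Some ` V) = {x. x \<noteq> \<infinity> \<and> complex_of_real (enn2real x) \<in> V}"
      by (auto simp: of_ennreal_def split: if_splits)
    also have "\<dots> \<in> sets borel"
      using that by measurable
    finally show ?thesis .
  qed
  fix U assume "U \<in> {U. openin (Alexandroff_compactification (euclidean :: complex topology)) U}"
  then consider V where "open V" "U = Some ` V"
    | K where "closed K" "U = insert None (Some ` (- K))"
    by (auto simp: openin_Alexandroff_compactification Compl_eq_Diff_UNIV)
  then show "of_ennreal -` U \<inter> space borel \<in> sets borel"
  proof cases
    case 1
    then show ?thesis using vimage_Some by simp
  next
    case 2
    have "of_ennreal -` U = - (of_ennreal -` (Some ` K))"
      unfolding 2(2) by (auto simp: notin_range_Some) (metis ComplI image_eqI option.exhaust)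
    moreover have "of_ennreal -` (Some ` K) \<in> sets borel"
      using 2(1) vimage_Some by simp
    ultimately show ?thesis by (simp add: borel_comp)
  qed
qed auto

lemma of_ennreal_in_M: "f \<in> Mplus \<Longrightarrow> (\<lambda>x. of_ennreal (f x)) \<in> M"
  unfolding Mplus_def M_def using measurable_compose[OF _ of_ennreal_measurable] by blast

section \<open>Distribution function and rearrangement of non-negative functions\<close>

definition edistr :: "(real \<Rightarrow> ennreal) \<Rightarrow> real \<Rightarrow> ennreal" where
  "edistr f s = emeasure \<lambda>\<^sub>+ {x \<in> space \<lambda>\<^sub>+. ennreal s < f x}"

definition erearr :: "(real \<Rightarrow> ennreal) \<Rightarrow> real \<Rightarrow> ennreal" where
  "erearr f t = Inf {ennreal s | s. s \<ge> 0 \<and> edistr f s \<le> ennreal t}"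

lemma distr_fun_eq: "distr_fun f = edistr (\<lambda>x. ecmod (f x))"
  by (simp add: fun_eq_iff distr_fun_def edistr_def)

lemma rearrangement_eq: "rearrangement f = erearr (\<lambda>x. ecmod (f x))"
  by (simp add: fun_eq_iff rearrangement_def erearr_def distr_fun_eq)

lemma superlevel_sets:
  assumes "f \<in> Mplus"
  shows "{x \<in> space \<lambda>\<^sub>+. c < f x} \<in> sets \<lambda>\<^sub>+"
  using assms unfolding Mplus_def by measurable

text \<open>Two separate levels are allowed so that the same fact serves monotonicity in the
  function and in the level.\<close>

lemma edistr_mono:
  assumes "g \<in> Mplus" "AE x in \<lambda>\<^sub>+. ennreal s < f x \<longrightarrow> ennreal s' < g x"
  shows "edistr f s \<le> edistr g s'"
  unfolding edistr_def using assms(2)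
  by (intro emeasure_mono_AE superlevel_sets assms) auto

lemma edistr_antimono:
  assumes "f \<in> Mplus" "0 \<le> s" "s \<le> s'"
  shows "edistr f s' \<le> edistr f s"
  using assms by (intro edistr_mono) (auto intro: le_less_trans ennreal_leI)

text \<open>The strict superlevel set at \<open>s\<close> is the increasing union of those at
  \<open>s + 1 / Suc n\<close>, so its measure is the supremum of theirs.\<close>

lemma edistr_right_continuous:
  assumes "f \<in> Mplus" "0 \<le> s" "\<And>n::nat. edistr f (s + 1 / real (Suc n)) \<le> c"
  shows "edistr f s \<le> c"
proof -
  define E where "E n = {x \<in> space \<lambda>\<^sub>+. ennreal (s + 1 / real (Suc n)) < f x}" for n
  have "{x \<in> space \<lambda>\<^sub>+. ennreal s < f x} = (\<Union>n. E n)"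
  proof (intro equalityI subsetI)
    fix x assume x: "x \<in> {x \<in> space \<lambda>\<^sub>+. ennreal s < f x}"
    then obtain c where "ennreal s < c" "c < f x"
      using dense by blast
    then obtain r where r: "ennreal s < ennreal r" "ennreal r < f x"
      by (cases c) auto
    then have "s < r" using assms(2) by (simp add: ennreal_less_iff)
    then obtain n where "s + 1 / real (Suc n) < r"
      using reals_Archimedean[of "r - s"] by (auto simp: field_simps)
    then have "ennreal (s + 1 / real (Suc n)) < f x"
      using r(2) by (meson ennreal_leI less_imp_le le_less_trans)
    then show "x \<in> (\<Union>n. E n)" using x by (auto simp: E_def)
  next
    fix x assume "x \<in> (\<Union>n. E n)"
    then obtain n where n: "x \<in> space \<lambda>\<^sub>+" "ennreal (s + 1 / real (Suc n)) < f x"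
      by (auto simp: E_def)
    have "ennreal s \<le> ennreal (s + 1 / real (Suc n))"
      by (intro ennreal_leI) simp
    with n show "x \<in> {x \<in> space \<lambda>\<^sub>+. ennreal s < f x}" by auto
  qed
  moreover have "incseq E"
  proof (rule incseq_SucI)
    fix n
    have "ennreal (s + 1 / real (Suc (Suc n))) \<le> ennreal (s + 1 / real (Suc n))"
      by (intro ennreal_leI add_left_mono) (simp add: field_simps)
    then show "E n \<subseteq> E (Suc n)" by (auto simp: E_def)
  qed
  moreover have "range E \<subseteq> sets \<lambda>\<^sub>+"
    using superlevel_sets[OF assms(1)] by (auto simp: E_def)
  ultimately have "edistr f s = (SUP n. emeasure \<lambda>\<^sub>+ (E n))"
    unfolding edistr_def by (simp add: SUP_emeasure_incseq)
  also have "\<dots> \<le> c"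
    using assms(3) by (intro SUP_least) (simp add: edistr_def E_def)
  finally show ?thesis .
qed

text \<open>Right-continuity of the distribution function makes the infimum defining
  \<open>erearr\<close> attained. The resulting Galois connection carries all later comparisons
  between rearrangements and distribution functions.\<close>

lemma erearr_le_iff:
  assumes "f \<in> Mplus" "0 \<le> s"
  shows "erearr f t \<le> ennreal s \<longleftrightarrow> edistr f s \<le> ennreal t"
proof
  assume le: "erearr f t \<le> ennreal s"
  show "edistr f s \<le> ennreal t"
  proof (rule edistr_right_continuous[OF assms])
    fix n :: nat
    have "ennreal s < ennreal (s + 1 / real (Suc n))"
      using assms(2) by (intro ennreal_lessI) (auto simp: add_nonneg_pos)
    with le have "erearr f t < ennreal (s + 1 / real (Suc n))" by simp
    then obtain r where r: "0 \<le> r" "edistr f r \<le> ennreal t" "ennreal r < ennreal (s + 1 / real (Suc n))"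
      unfolding erearr_def Inf_less_iff by auto
    then have "r < s + 1 / real (Suc n)" by (metis ennreal_less_iff)
    then have "edistr f (s + 1 / real (Suc n)) \<le> edistr f r"
      using assms r(1) by (intro edistr_antimono) auto
    with r(2) show "edistr f (s + 1 / real (Suc n)) \<le> ennreal t" by simp
  qed
next
  assume "edistr f s \<le> ennreal t"
  then show "erearr f t \<le> ennreal s"
    unfolding erearr_def using assms(2) by (intro Inf_lower) auto
qed

lemma less_erearr_iff:
  assumes "f \<in> Mplus" "0 \<le> s"
  shows "ennreal s < erearr f t \<longleftrightarrow> ennreal t < edistr f s"
  using erearr_le_iff[OF assms] by (meson not_le)

text \<open>An infinite \<open>y\<close> is trivial, so only finite upper bounds need testing; these
  are exactly the bounds that \<open>erearr_le_iff\<close> handles.\<close>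

lemma ennreal_le_by_reals:
  assumes "\<And>s. 0 \<le> s \<Longrightarrow> (y::ennreal) \<le> ennreal s \<Longrightarrow> x \<le> ennreal s"
  shows "x \<le> y"
  using assms by (cases y) auto

lemma erearr_antimono: "t \<le> t' \<Longrightarrow> erearr f t' \<le> erearr f t"
  unfolding erearr_def by (intro Inf_superset_mono) (use ennreal_leI order_trans in blast)

lemma erearr_mono:
  assumes "\<And>s. 0 \<le> s \<Longrightarrow> edistr f s \<le> edistr g s"
  shows "erearr f t \<le> erearr g t"
  unfolding erearr_def using assms by (intro Inf_superset_mono) (use order_trans in blast)

text \<open>By monotonicity in \<open>t\<close> every set \<open>{t. a \<le> erearr f t}\<close> is
  an interval, hence Borel.\<close>

lemma erearr_Mplus [simp]: "erearr f \<in> Mplus"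
proof -
  have "(\<lambda>t. erearr f t) \<in> borel_measurable borel"
  proof -
    have "{t. a \<le> erearr f t} \<in> sets borel" for a
    proof -
      have "is_interval {t. a \<le> erearr f t}"
        unfolding is_interval_1 using erearr_antimono order_trans by blast
      then show ?thesis
        by (intro real_interval_borel_measurable)
    qed
    then show ?thesis by (intro borel_measurableI_ge) simp
  qed
  then show ?thesis
    unfolding Mplus_def by (simp add: measurable_restrict_space1 measurable_completion)
qed

lemma emeasure_halfline:
  assumes "A \<in> sets borel" "A \<subseteq> {0..}"
  shows "emeasure \<lambda>\<^sub>+ A = emeasure lborel A"
  using assms by (simp add: emeasure_restrict_space)

text \<open>By \<open>less_erearr_iff\<close>, the superlevel sets of a rearrangement are initial
  segments of this shape, with \<open>c\<close> a value of the distribution function; infinite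
  \<open>c\<close> must therefore be covered.\<close>

lemma emeasure_halfline_below: "emeasure \<lambda>\<^sub>+ {t \<in> space \<lambda>\<^sub>+. ennreal t < c} = c"
proof (cases c)
  case (real r)
  then have "{t \<in> space \<lambda>\<^sub>+. ennreal t < c} = {0..<r}"
    by (auto simp: ennreal_less_iff space_restrict_space)
  moreover have "emeasure \<lambda>\<^sub>+ {0..<r} = ennreal r"
    using real by (subst emeasure_halfline) auto
  ultimately show ?thesis using real by simp
next
  case top
  have "{t \<in> space \<lambda>\<^sub>+. ennreal t < c} = {0..}"
    using top by (auto simp: space_restrict_space)
  moreover have "emeasure lborel {0::real..} = \<infinity>"
  proof -
    have "of_nat n \<le> emeasure lborel {0::real..}" for n :: nat
      using emeasure_mono[of "{0..real n}" "{0::real..}" lborel] by (simp add: ennreal_of_nat_eq_real_of_nat)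
    then show ?thesis by (metis ennreal_SUP_of_nat_eq_top SUP_least infinity_ennreal_def top.extremum_unique)
  qed
  ultimately show ?thesis using top by (simp add: emeasure_halfline)
qed

text \<open>Measures the part of a superlevel segment lying beyond 2, the bound on the measure of
  the set carrying two excesses.\<close>

lemma emeasure_halfline_between_le:
  "emeasure \<lambda>\<^sub>+ {t. 2 < t \<and> ennreal t < 2 + c} \<le> c"
proof (cases c)
  case (real r)
  then have "{t. 2 < t \<and> ennreal t < 2 + c} = {2<..<2 + r}"
    by (auto simp: space_restrict_space ennreal_less_iff simp flip: ennreal_numeral ennreal_plus)
  moreover have "emeasure \<lambda>\<^sub>+ {2<..<2 + r} = ennreal r"
    using real by (subst emeasure_halfline) auto
  ultimately show ?thesis using real by simp
qed simp

lemma edistr_erearr: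
  assumes "f \<in> Mplus" "0 \<le> s"
  shows "edistr (erearr f) s = edistr f s"
  unfolding edistr_def[of "erearr f"] less_erearr_iff[OF assms]
  by (rule emeasure_halfline_below)

lemma indicator_Mplus [simp]: "S \<in> sets borel \<Longrightarrow> indicator S \<in> Mplus"
  unfolding Mplus_def by (simp add: measurable_restrict_space1 measurable_completion)

lemma times_Mplus [simp]: "f \<in> Mplus \<Longrightarrow> g \<in> Mplus \<Longrightarrow> (\<lambda>x. f x * g x) \<in> Mplus"
  unfolding Mplus_def by measurable

lemma plus_Mplus [simp]: "f \<in> Mplus \<Longrightarrow> g \<in> Mplus \<Longrightarrow> (\<lambda>x. f x + g x) \<in> Mplus"
  unfolding Mplus_def by measurable

lemma const_Mplus [simp]: "(\<lambda>x. c) \<in> Mplus"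
  unfolding Mplus_def by measurable

lemma diff_Mplus [simp]: "f \<in> Mplus \<Longrightarrow> (\<lambda>x. f x - c) \<in> Mplus"
  unfolding Mplus_def by (simp add: borel_measurable_minus_ennreal)

lemma min_Mplus [simp]: "f \<in> Mplus \<Longrightarrow> (\<lambda>x. min (f x) c) \<in> Mplus"
  unfolding Mplus_def by measurable

lemma ennreal_less_diff_iff:
  assumes "0 \<le> s" "0 \<le> a"
  shows "ennreal s < x - ennreal a \<longleftrightarrow> ennreal (s + a) < x"
  using assms by (cases x) (auto simp: ennreal_minus ennreal_less_iff simp del: ennreal_plus)

lemma ennreal_diff_plus_min: "a < top \<Longrightarrow> (x::ennreal) = (x - a) + min x a"
  by (cases x; cases a) (auto simp: ennreal_minus ennreal_neg min_def simp flip: ennreal_plus)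

lemma ennreal_le_diff_add: "(x::ennreal) \<le> (x - ennreal a) + ennreal a"
  by (cases x) (auto simp: ennreal_minus_if simp flip: ennreal_plus)

lemma edistr_diff:
  assumes "0 \<le> s" "0 \<le> a"
  shows "edistr (\<lambda>x. f x - ennreal a) s = edistr f (s + a)"
  unfolding edistr_def ennreal_less_diff_iff[OF assms] ..

text \<open>A sum exceeds \<open>s + s'\<close> only where one of the summands exceeds its own
  share.\<close>

lemma edistr_add_le:
  assumes "f \<in> Mplus" "g \<in> Mplus" "0 \<le> s" "0 \<le> s'"
  shows "edistr (\<lambda>x. f x + g x) (s + s') \<le> edistr f s + edistr g s'"
proof -
  have "{x \<in> space \<lambda>\<^sub>+. ennreal (s + s') < f x + g x}
      \<subseteq> {x \<in> space \<lambda>\<^sub>+. ennreal s < f x} \<union> {x \<in> space \<lambda>\<^sub>+. ennreal s' < g x}"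
    using assms(3,4) by (auto simp: not_less) (meson add_mono leD not_less)
  then have "edistr (\<lambda>x. f x + g x) (s + s')
      \<le> emeasure \<lambda>\<^sub>+ ({x \<in> space \<lambda>\<^sub>+. ennreal s < f x} \<union> {x \<in> space \<lambda>\<^sub>+. ennreal s' < g x})"
    unfolding edistr_def using assms(1,2) by (intro emeasure_mono sets.Un superlevel_sets)
  also have "\<dots> \<le> edistr f s + edistr g s'"
    unfolding edistr_def using assms(1,2) by (intro emeasure_subadditive superlevel_sets)
  finally show ?thesis .
qed

lemma edistr_eq_0_iff:
  assumes "f \<in> Mplus"
  shows "edistr f 0 = 0 \<longleftrightarrow> (AE x in \<lambda>\<^sub>+. f x = 0)"
  using superlevel_sets[OF assms, of 0]
  by (subst AE_iff_measurable[where N = "{x \<in> space \<lambda>\<^sub>+. 0 < f x}"])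
    (auto simp: edistr_def zero_less_iff_neq_zero)

text \<open>Scaling by a positive factor moves level \<open>s\<close> to level \<open>s / a\<close>
  of the original function; both sides thus have the same finite upper bounds.\<close>

lemma erearr_cmult:
  assumes "f \<in> Mplus" "0 < a"
  shows "erearr (\<lambda>x. ennreal a * f x) t = ennreal a * erearr f t"
proof -
  have scale: "ennreal a * x \<le> ennreal s \<longleftrightarrow> x \<le> ennreal (s / a)" if "0 \<le> s" for s x
    using assms(2) that
  proof (cases x)
    case (real r)
    then have "ennreal a * x = ennreal (a * r)" using assms(2) by (simp add: ennreal_mult)
    then show ?thesis using real assms(2) that by (simp add: field_simps)
  next
    case top
    then show ?thesis using assms(2) by (simp add: ennreal_mult_top top_unique)
  qed
  have "edistr (\<lambda>x. ennreal a * f x) s = edistr f (s / a)" if "0 \<le> s" for s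
  proof -
    have "ennreal s < ennreal a * x \<longleftrightarrow> ennreal (s / a) < x" for x
      using scale[OF that, of x] by (meson not_le)
    then show ?thesis by (simp add: edistr_def)
  qed
  then have iff: "erearr (\<lambda>x. ennreal a * f x) t \<le> ennreal s \<longleftrightarrow> ennreal a * erearr f t \<le> ennreal s"
    if "0 \<le> s" for s
    using assms that by (simp add: erearr_le_iff scale)
  show ?thesis
  proof (rule antisym)
    show "erearr (\<lambda>x. ennreal a * f x) t \<le> ennreal a * erearr f t"
      by (rule ennreal_le_by_reals) (simp only: iff)
    show "ennreal a * erearr f t \<le> erearr (\<lambda>x. ennreal a * f x) t"
      by (rule ennreal_le_by_reals) (simp only: iff)
  qed
qed

text \<open>A finite bound \<open>s\<close> on all \<open>erearr (F n) t\<close> says that every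
  superlevel set of \<open>F n\<close> at \<open>s\<close> has measure at most \<open>t\<close>;
  continuity from below passes this on to \<open>f\<close>.\<close>

lemma erearr_monotone_convergence:
  assumes F: "\<And>n. F n \<in> Mplus" and f: "f \<in> Mplus"
    and AE: "AE x in \<lambda>\<^sub>+. incseq (\<lambda>n. F n x) \<and> (\<lambda>n. F n x) \<longlonglongrightarrow> f x"
  shows "incseq (\<lambda>n. erearr (F n) t)" "(\<lambda>n. erearr (F n) t) \<longlonglongrightarrow> erearr f t"
proof -
  show inc: "incseq (\<lambda>n. erearr (F n) t)"
  proof (intro incseq_SucI erearr_mono edistr_mono F)
    fix n s
    show "AE x in \<lambda>\<^sub>+. ennreal s < F n x \<longrightarrow> ennreal s < F (Suc n) x"
      using AE by eventually_elim (metis incseq_SucD less_le_trans)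
  qed
  have le: "erearr (F n) t \<le> erearr f t" for n
  proof (intro erearr_mono edistr_mono f)
    fix s
    show "AE x in \<lambda>\<^sub>+. ennreal s < F n x \<longrightarrow> ennreal s < f x"
      using AE by eventually_elim (metis incseq_le less_le_trans)
  qed
  have "erearr f t \<le> (SUP n. erearr (F n) t)"
  proof (rule ennreal_le_by_reals)
    fix s :: real assume s: "0 \<le> s" and "(SUP n. erearr (F n) t) \<le> ennreal s"
    then have F_le: "edistr (F n) s \<le> ennreal t" for n
      using F by (simp add: SUP_le_iff erearr_le_iff)
    define E where "E g = {x \<in> space \<lambda>\<^sub>+. ennreal s < g x}" for g :: "real \<Rightarrow> ennreal"
    have E: "E g \<in> sets \<lambda>\<^sub>+" if "g \<in> Mplus" for g
      using superlevel_sets[OF that] by (simp add: E_def)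
    have int_E: "(\<integral>\<^sup>+x. indicator (E g) x \<partial>\<lambda>\<^sub>+) = edistr g s" if "g \<in> Mplus" for g
      using E[OF that] by (simp add: edistr_def E_def)
    \<comment> \<open>The superlevel sets increase to that of \<open>f\<close> only up to null sets,
      so continuity from below is expressed through integrals of indicators, where almost-everywhere
      hypotheses suffice.\<close>
    have "edistr f s = (\<integral>\<^sup>+x. indicator (E f) x \<partial>\<lambda>\<^sub>+)"
      using int_E f by simp
    also have "\<dots> \<le> (\<integral>\<^sup>+x. (SUP n. indicator (E (F n)) x) \<partial>\<lambda>\<^sub>+)"
    proof (rule nn_integral_mono_AE)
      show "AE x in \<lambda>\<^sub>+. indicator (E f) x \<le> (SUP n. indicator (E (F n)) x :: ennreal)"
        using AE
      proof eventually_elim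
        case (elim x)
        show ?case
        proof (cases "x \<in> E f")
          case True
          \<comment> \<open>The inequality \<open>ennreal s < f x\<close> is strict, so it already
            holds along the convergent sequence.\<close>
          then obtain n where "ennreal s < F n x"
            using order_tendstoD(1)[of "\<lambda>n. F n x" "f x" sequentially "ennreal s"] elim
            by (auto simp: E_def eventually_sequentially)
          then have "x \<in> E (F n)" using True by (simp add: E_def)
          then have "1 \<le> (indicator (E (F n)) x :: ennreal)" by simp
          then have "1 \<le> (SUP n. indicator (E (F n)) x :: ennreal)" by (rule SUP_upper2[OF UNIV_I])
          then show ?thesis using True by simp
        qed simp
      qed
    qed
    also have "\<dots> = (SUP n. \<integral>\<^sup>+x. indicator (E (F n)) x \<partial>\<lambda>\<^sub>+)"
    proof (rule nn_integral_monotone_convergence_SUP_AE)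
      fix n
      show "AE x in \<lambda>\<^sub>+. indicator (E (F n)) x \<le> (indicator (E (F (Suc n))) x :: ennreal)"
        using AE by eventually_elim
          (auto simp: E_def split: split_indicator dest: incseq_SucD intro: less_le_trans)
      show "(\<lambda>x. indicator (E (F n)) x :: ennreal) \<in> borel_measurable \<lambda>\<^sub>+"
        using E[OF F] by simp
    qed
    also have "\<dots> \<le> ennreal t"
      using F_le by (simp add: int_E F SUP_le_iff)
    finally show "erearr f t \<le> ennreal s"
      using f s by (simp add: erearr_le_iff)
  qed
  with le have "(SUP n. erearr (F n) t) = erearr f t"
    by (intro antisym SUP_least)
  then show "(\<lambda>n. erearr (F n) t) \<longlonglongrightarrow> erearr f t"
    using LIMSEQ_SUP[OF inc] by simp
qed

section \<open>The two pieces of the rearrangement, split at 1\<close>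

definition inner_part :: "(real \<Rightarrow> ennreal) \<Rightarrow> real \<Rightarrow> ennreal" where
  "inner_part f t = erearr f t * indicator {0..1} t"

definition outer_part :: "(real \<Rightarrow> ennreal) \<Rightarrow> real \<Rightarrow> ennreal" where
  "outer_part f t = erearr f t * indicator {1<..} t"

lemma inner_part_Mplus [simp]: "inner_part f \<in> Mplus"
  unfolding inner_part_def by simp

lemma outer_part_Mplus [simp]: "outer_part f \<in> Mplus"
  unfolding outer_part_def by simp

lemma on_nonneg_WL_norm:
  "on_nonneg (WL_norm A B) f = on_nonneg A (inner_part f) + on_nonneg B (outer_part f)"
  by (simp add: on_nonneg_def WL_norm_def rearrangement_eq inner_part_def outer_part_def)

section \<open>Estimates for a single rearrangement-invariant norm\<close>

locale ri_norm =
  fixes N :: fnorm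
  assumes norm: "banach_function_norm N" and ri: "rearrangement_invariant N"
begin

abbreviation norm_of :: "(real \<Rightarrow> ennreal) \<Rightarrow> ennreal" where
  "norm_of \<equiv> on_nonneg N"

lemma norm_mono_AE:
  "f \<in> Mplus \<Longrightarrow> g \<in> Mplus \<Longrightarrow> (AE x in \<lambda>\<^sub>+. f x \<le> g x) \<Longrightarrow> norm_of f \<le> norm_of g"
  using norm by (auto simp: banach_function_norm_def axiom_P2_def)

lemma norm_mono:
  "f \<in> Mplus \<Longrightarrow> g \<in> Mplus \<Longrightarrow> (\<And>x. 0 \<le> x \<Longrightarrow> f x \<le> g x) \<Longrightarrow> norm_of f \<le> norm_of g"
  by (rule norm_mono_AE) (auto intro!: AE_I2 simp: space_restrict_space)

lemma norm_triangle:
  "f \<in> Mplus \<Longrightarrow> g \<in> Mplus \<Longrightarrow> norm_of (\<lambda>x. f x + g x) \<le> norm_of f + norm_of g"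
  using norm by (auto simp: banach_function_norm_def axiom_P1_def)

lemma norm_cmult:
  "f \<in> Mplus \<Longrightarrow> 0 \<le> a \<Longrightarrow> norm_of (\<lambda>x. ennreal a * f x) = ennreal a * norm_of f"
  using norm by (auto simp: banach_function_norm_def axiom_P1_def pos_homogeneous_def)

lemma norm_eq_0_iff: "f \<in> Mplus \<Longrightarrow> norm_of f = 0 \<longleftrightarrow> (AE x in \<lambda>\<^sub>+. f x = 0)"
  using norm by (auto simp: banach_function_norm_def axiom_P1_def definite_def)

lemma norm_monotone_convergence:
  assumes "\<And>n. F n \<in> Mplus" "f \<in> Mplus"
    "\<And>x. incseq (\<lambda>n. F n x)" "\<And>x. (\<lambda>n. F n x) \<longlonglongrightarrow> f x"
  shows "incseq (\<lambda>n. norm_of (F n))" "(\<lambda>n. norm_of (F n)) \<longlonglongrightarrow> norm_of f"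
  using norm assms by (auto simp: banach_function_norm_def axiom_P3_def)

lemma norm_indicator_finite:
  "S \<in> sets \<lambda>\<^sub>+ \<Longrightarrow> emeasure \<lambda>\<^sub>+ S < \<infinity> \<Longrightarrow> norm_of (indicator S) < \<infinity>"
  using norm by (auto simp: banach_function_norm_def axiom_P4_def)

lemma nn_integral_le_norm:
  assumes "S \<in> sets \<lambda>\<^sub>+" "emeasure \<lambda>\<^sub>+ S < \<infinity>"
  obtains C where "0 \<le> C" "\<And>f. f \<in> Mplus \<Longrightarrow> (\<integral>\<^sup>+x\<in>S. f x \<partial>\<lambda>\<^sub>+) \<le> ennreal C * norm_of f"
  using norm assms by (auto simp: banach_function_norm_def axiom_P5_def)

lemma norm_erearr:
  assumes "f \<in> Mplus"
  shows "norm_of (erearr f) = norm_of f"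
proof -
  have "equimeasurable (\<lambda>x. of_ennreal (erearr f x)) (\<lambda>x. of_ennreal (f x))"
    using assms by (simp add: equimeasurable_def distr_fun_eq edistr_erearr)
  then show ?thesis
    using ri of_ennreal_in_M[OF assms] of_ennreal_in_M[OF erearr_Mplus]
    unfolding rearrangement_invariant_def on_nonneg_def by blast
qed

text \<open>Passing to rearrangements turns an order between distribution functions into a pointwise
  one, to which (P2) applies.\<close>

lemma norm_mono_edistr:
  assumes "f \<in> Mplus" "g \<in> Mplus" "\<And>s. 0 \<le> s \<Longrightarrow> edistr f s \<le> edistr g s"
  shows "norm_of f \<le> norm_of g"
proof -
  have "norm_of (erearr f) \<le> norm_of (erearr g)"
    using assms(3) by (intro norm_mono erearr_mono) auto
  then show ?thesis using assms by (simp add: norm_erearr)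
qed

text \<open>The excess exceeds \<open>s\<close> on a set of measure
  \<open>d = edistr f (s + a)\<close>. The bound on \<open>erearr f 1\<close> gives
  \<open>d \<le> 1\<close>, so the segment \<open>[0,d)\<close> lies inside \<open>[0,1]\<close>,
  and on it \<open>erearr f\<close> exceeds \<open>s\<close>.\<close>

lemma norm_diff_le_inner:
  assumes "f \<in> Mplus" "0 \<le> a" "erearr f 1 \<le> ennreal a"
  shows "norm_of (\<lambda>x. f x - ennreal a) \<le> norm_of (inner_part f)"
proof (rule norm_mono_edistr)
  fix s :: real assume s: "0 \<le> s"
  define d where "d = edistr f (s + a)"
  have "d \<le> edistr f a" "d \<le> edistr f s"
    using assms s by (auto simp: d_def intro!: edistr_antimono)
  moreover have "edistr f a \<le> 1"
    using assms erearr_le_iff[of f a 1] by simp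
  ultimately have "d \<le> 1" "d \<le> edistr f s" by auto
  have "{t \<in> space \<lambda>\<^sub>+. ennreal t < d} \<subseteq> {t \<in> space \<lambda>\<^sub>+. ennreal s < inner_part f t}"
  proof safe
    fix t assume "t \<in> space \<lambda>\<^sub>+" "ennreal t < d"
    moreover have "t < 1"
      using less_le_trans[OF \<open>ennreal t < d\<close> \<open>d \<le> 1\<close>] by (simp add: ennreal_less_one_iff)
    ultimately show "ennreal s < inner_part f t"
      using \<open>d \<le> edistr f s\<close> assms(1) s
      by (auto simp: inner_part_def less_erearr_iff space_restrict_space indicator_def)
  qed
  then have "emeasure \<lambda>\<^sub>+ {t \<in> space \<lambda>\<^sub>+. ennreal t < d} \<le> edistr (inner_part f) s"
    unfolding edistr_def by (intro emeasure_mono superlevel_sets inner_part_Mplus)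
  then have "d \<le> edistr (inner_part f) s"
    by (simp only: emeasure_halfline_below)
  then show "edistr (\<lambda>x. f x - ennreal a) s \<le> edistr (inner_part f) s"
    using assms s by (simp add: d_def edistr_diff)
qed (use assms in auto)

lemma norm_min_le_outer:
  assumes "f \<in> Mplus" "0 \<le> a" "ennreal a \<le> erearr f 1"
  shows "norm_of (\<lambda>x. min (f x) (ennreal a))
    \<le> norm_of (outer_part f) + ennreal a * norm_of (indicator {0..1})"
proof -
  define g :: "real \<Rightarrow> ennreal" where "g t = outer_part f t + ennreal a * indicator {0..1} t" for t
  have g: "g \<in> Mplus" unfolding g_def by simp
  have "norm_of (\<lambda>x. min (f x) (ennreal a)) \<le> norm_of g"
  proof (rule norm_mono_edistr)
    fix s :: real assume s: "0 \<le> s"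
    show "edistr (\<lambda>x. min (f x) (ennreal a)) s \<le> edistr g s"
    \<comment> \<open>Below height \<open>a\<close>, \<open>g\<close> exceeds \<open>s\<close> on
      all of \<open>[0,1]\<close>, and beyond 1 it equals the rearrangement of \<open>f\<close>.
      From height \<open>a\<close> on, the truncation has empty superlevel sets.\<close>
    proof (cases "s < a")
      case True
      have "edistr (\<lambda>x. min (f x) (ennreal a)) s \<le> edistr f s"
        using assms by (intro edistr_mono) auto
      also have "\<dots> = emeasure \<lambda>\<^sub>+ {t \<in> space \<lambda>\<^sub>+. ennreal t < edistr f s}"
        by (rule emeasure_halfline_below[symmetric])
      also have "\<dots> \<le> edistr g s"
        unfolding edistr_def[of g]
      proof (intro emeasure_mono superlevel_sets[OF g], safe)
        fix t assume "t \<in> space \<lambda>\<^sub>+" "ennreal t < edistr f s"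
        then show "ennreal s < g t"
          using True assms s
          by (auto simp: g_def outer_part_def less_erearr_iff space_restrict_space indicator_def ennreal_less_iff)
      qed
      finally show ?thesis .
    next
      case False
      then have "\<not> ennreal s < min (f x) (ennreal a)" for x
        by (auto simp: not_less intro: min.coboundedI2 ennreal_leI)
      then have "edistr (\<lambda>x. min (f x) (ennreal a)) s = 0"
        unfolding edistr_def by (simp del: min_less_iff_conj)
      then show ?thesis by simp
    qed
  qed (use assms g in auto)
  also have "\<dots> \<le> norm_of (outer_part f) + norm_of (\<lambda>t. ennreal a * indicator {0..1} t)"
    unfolding g_def by (intro norm_triangle) auto
  finally show ?thesis using assms by (simp add: norm_cmult)
qed

text \<open>Finiteness is (P4), positivity is definiteness. Dividing by this number lets the norm of
  the inner part control the height \<open>erearr f 1\<close>.\<close>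

lemma norm_unit_interval:
  obtains r where "0 < r" "norm_of (indicator {0..1}) = ennreal r"
proof -
  have S: "{0..1::real} \<in> sets \<lambda>\<^sub>+"
    by (auto simp: sets_restrict_space_iff)
  have "emeasure \<lambda>\<^sub>+ {0..1::real} = 1"
    by (subst emeasure_halfline) auto
  then have "norm_of (indicator {0..1}) < \<infinity>"
    using S by (intro norm_indicator_finite) auto
  moreover have "norm_of (indicator {0..1}) \<noteq> 0"
  proof
    assume "norm_of (indicator {0..1}) = 0"
    then have "AE x in \<lambda>\<^sub>+. x \<notin> {0..1}"
      by (simp add: norm_eq_0_iff indicator_eq_0_iff)
    then have "emeasure \<lambda>\<^sub>+ {0..1::real} = 0"
      using S by (subst (asm) AE_iff_measurable[where N = "{0..1}"]) (auto simp: space_restrict_space)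
    with \<open>emeasure \<lambda>\<^sub>+ {0..1::real} = 1\<close> show False by simp
  qed
  ultimately show ?thesis
    using that by (cases "norm_of (indicator {0..1})") (auto simp: less_le)
qed

text \<open>On \<open>[0,1]\<close> the rearrangement is at least its value at 1.\<close>

lemma erearr_1_le_inner:
  "erearr f 1 * norm_of (indicator {0..1}) \<le> norm_of (inner_part f)"
proof -
  have bound: "ennreal a * norm_of (indicator {0..1}) \<le> norm_of (inner_part f)"
    if "0 \<le> a" "ennreal a \<le> erearr f 1" for a
  proof -
    have "norm_of (\<lambda>t. ennreal a * indicator {0..1} t) \<le> norm_of (inner_part f)"
      by (intro norm_mono)
        (use that in \<open>auto simp: inner_part_def split: split_indicator intro: order_trans erearr_antimono\<close>)
    then show ?thesis using that by (simp add: norm_cmult)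
  qed
  show ?thesis
  proof (cases "erearr f 1")
    case (real a)
    then show ?thesis using bound[of a] by simp
  next
    case top
    \<comment> \<open>Homogeneity covers finite scalars only, so an infinite height is reached
      through the natural numbers.\<close>
    have "erearr f 1 * norm_of (indicator {0..1})
        = (SUP n. of_nat n) * norm_of (indicator {0..1})"
      using top by (simp add: ennreal_SUP_of_nat_eq_top)
    also have "\<dots> = (SUP n. of_nat n * norm_of (indicator {0..1}))"
      by (simp add: SUP_mult_right_ennreal)
    also have "\<dots> \<le> norm_of (inner_part f)"
      using bound top by (intro SUP_least) (simp add: ennreal_of_nat_eq_real_of_nat)
    finally show ?thesis .
  qed
qed

text \<open>Absorbs a height weighted by a foreign constant \<open>p\<close>, either a norm in the
  other space or the measure of a set, into the inner part.\<close>

lemma erearr_1_times_le_inner: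
  assumes "0 < r" "norm_of (indicator {0..1}) = ennreal r" "0 \<le> p"
  shows "erearr f 1 * ennreal p \<le> ennreal (p / r) * norm_of (inner_part f)"
proof -
  have "erearr f 1 * ennreal p = ennreal (p / r) * (erearr f 1 * ennreal r)"
    using assms by (simp add: mult.left_commute flip: ennreal_mult)
  also have "\<dots> \<le> ennreal (p / r) * norm_of (inner_part f)"
    using erearr_1_le_inner[of f] assms(2) by (intro mult_left_mono) auto
  finally show ?thesis .
qed

lemma inner_part_add_le:
  assumes f: "f \<in> Mplus" and g: "g \<in> Mplus"
  shows "norm_of (inner_part (\<lambda>x. f x + g x)) \<le> 2 * (norm_of (inner_part f) + norm_of (inner_part g))"
\<comment> \<open>An infinite height forces an infinite norm of the corresponding inner part, so the
  right-hand side is infinite.\<close>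
proof (cases "erearr f 1 = \<infinity> \<or> erearr g 1 = \<infinity>")
  case True
  obtain r where r: "0 < r" "norm_of (indicator {0..1}) = ennreal r"
    by (rule norm_unit_interval)
  with True have "norm_of (inner_part f) = \<infinity> \<or> norm_of (inner_part g) = \<infinity>"
    using erearr_1_le_inner[of f] erearr_1_le_inner[of g] by (auto simp: ennreal_top_mult top_unique)
  then show ?thesis by (auto simp: ennreal_mult_top)
next
  case False
  then obtain a b where a: "0 \<le> a" "erearr f 1 = ennreal a" and b: "0 \<le> b" "erearr g 1 = ennreal b"
    by (metis ennreal_cases infinity_ennreal_def)
  define h where "h x = f x + g x" for x
  have h: "h \<in> Mplus" using f g unfolding h_def by simp
  have ab: "0 \<le> a + b" using a b by simp
  \<comment> \<open>The rearrangement of \<open>h\<close> is cut at height \<open>a + b\<close>. The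
    excess and the remaining plateau on \<open>[0,1]\<close> each cost one copy of the sum of inner
    norms, whence the factor 2.\<close>
  have "norm_of (inner_part h)
      \<le> norm_of (\<lambda>t. (erearr h t - ennreal (a + b)) + ennreal (a + b) * indicator {0..1} t)"
    by (intro norm_mono plus_Mplus times_Mplus diff_Mplus)
      (auto simp: inner_part_def split: split_indicator simp del: ennreal_plus
        intro: ennreal_le_diff_add)
  also have "\<dots> \<le> norm_of (\<lambda>t. erearr h t - ennreal (a + b))
      + ennreal (a + b) * norm_of (indicator {0..1})"
    using norm_triangle[of "\<lambda>t. erearr h t - ennreal (a + b)" "\<lambda>t. ennreal (a + b) * indicator {0..1} t"] ab
    by (simp add: norm_cmult del: ennreal_plus)
  \<comment> \<open>Both functions have distribution \<open>edistr h (s + (a + b))\<close> at level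
    \<open>s\<close>, so the rearrangement can be replaced by \<open>h\<close> itself, where
    addition is pointwise.\<close>
  also have "norm_of (\<lambda>t. erearr h t - ennreal (a + b)) \<le> norm_of (\<lambda>x. h x - ennreal (a + b))"
    using h ab by (intro norm_mono_edistr) (auto simp: edistr_diff edistr_erearr simp del: ennreal_plus)
  also have "\<dots> \<le> norm_of (\<lambda>x. (f x - ennreal a) + (g x - ennreal b))"
  proof (intro norm_mono plus_Mplus diff_Mplus f g h)
    fix x
    have "h x \<le> ((f x - ennreal a) + ennreal a) + ((g x - ennreal b) + ennreal b)"
      unfolding h_def by (intro add_mono ennreal_le_diff_add)
    then show "h x - ennreal (a + b) \<le> (f x - ennreal a) + (g x - ennreal b)"
      using a b by (simp add: ennreal_minus_le_iff ac_simps)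
  qed
  also have "\<dots> \<le> norm_of (\<lambda>x. f x - ennreal a) + norm_of (\<lambda>x. g x - ennreal b)"
    using f g by (intro norm_triangle) auto
  also have "\<dots> \<le> norm_of (inner_part f) + norm_of (inner_part g)"
    using a b f g by (intro add_mono norm_diff_le_inner) auto
  also have "ennreal (a + b) * norm_of (indicator {0..1}) \<le> norm_of (inner_part f) + norm_of (inner_part g)"
    using add_mono[OF erearr_1_le_inner[of f] erearr_1_le_inner[of g]] a b
    by (simp add: distrib_right)
  finally show ?thesis
    by (simp add: h_def[abs_def] mult_2 ac_simps)
qed

text \<open>The heights \<open>a\<close>, \<open>b\<close>, \<open>c\<close> stay explicit: in the
  amalgam this estimate is applied to \<open>B\<close>, while the heights are controlled by the
  inner norm of \<open>A\<close>.\<close>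

lemma outer_part_add_le:
  assumes f: "f \<in> Mplus" and g: "g \<in> Mplus" and a: "0 \<le> a" "erearr f 1 = ennreal a"
    and b: "0 \<le> b" "erearr g 1 = ennreal b"
    and c: "0 \<le> c" "erearr (\<lambda>x. f x + g x) 1 = ennreal c"
  shows "norm_of (outer_part (\<lambda>x. f x + g x))
    \<le> ennreal c * norm_of (indicator {1<..2})
      + (norm_of (outer_part f) + ennreal a * norm_of (indicator {0..1})
        + (norm_of (outer_part g) + ennreal b * norm_of (indicator {0..1})))"
proof -
  define h where "h x = f x + g x" for x
  define F where "F x = (f x - ennreal a) + (g x - ennreal b)" for x
  define G where "G x = min (f x) (ennreal a) + min (g x) (ennreal b)" for x
  define tail where "tail t = erearr h t * indicator {2<..} t" for t
  have meas: "h \<in> Mplus" "F \<in> Mplus" "G \<in> Mplus" "tail \<in> Mplus"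
    using f g unfolding h_def F_def G_def tail_def by auto
  have h_split: "h = (\<lambda>x. F x + G x)"
  proof
    fix x
    show "h x = F x + G x"
      using ennreal_diff_plus_min[of "ennreal a" "f x"] ennreal_diff_plus_min[of "ennreal b" "g x"]
      unfolding h_def F_def G_def by (metis add.assoc add.left_commute ennreal_less_top)
  qed
  have "edistr F 0 \<le> 2"
  proof -
    have "edistr F 0 \<le> edistr (\<lambda>x. f x - ennreal a) 0 + edistr (\<lambda>x. g x - ennreal b) 0"
      using edistr_add_le[of "\<lambda>x. f x - ennreal a" "\<lambda>x. g x - ennreal b" 0 0] f g
      by (simp add: F_def[abs_def])
    also have "\<dots> \<le> 1 + 1"
      using erearr_le_iff[OF f a(1), of 1] erearr_le_iff[OF g b(1), of 1] a b
      by (intro add_mono) (auto simp: edistr_diff)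
    finally show ?thesis by simp
  qed
  \<comment> \<open>The whole level \<open>s\<close> is assigned to \<open>G\<close>, level 0 to
    \<open>F\<close>: off the support of the excesses, \<open>h\<close> equals
    \<open>G\<close>.\<close>
  then have h_le: "edistr h s \<le> 2 + edistr G s" if "0 \<le> s" for s
    using edistr_add_le[OF meas(2,3), of 0 s] that
    by (auto simp: h_split intro: order_trans add_mono)
  have "norm_of tail \<le> norm_of G"
  proof (rule norm_mono_edistr)
    fix s :: real assume s: "0 \<le> s"
    \<comment> \<open>If the tail exceeds \<open>s\<close> at \<open>t\<close>, then
      \<open>2 < t\<close> and \<open>ennreal t < edistr h s\<close>; the 2 in \<open>h_le\<close>
      is cancelled by starting at 2.\<close>
    have "edistr tail s \<le> emeasure \<lambda>\<^sub>+ {t. 2 < t \<and> ennreal t < 2 + edistr G s}"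
      unfolding edistr_def[of tail]
    proof (rule emeasure_mono)
      show "{t. 2 < t \<and> ennreal t < 2 + edistr G s} \<in> sets \<lambda>\<^sub>+"
        by (auto simp: sets_restrict_space_iff)
      show "{t \<in> space \<lambda>\<^sub>+. ennreal s < tail t} \<subseteq> {t. 2 < t \<and> ennreal t < 2 + edistr G s}"
        using less_erearr_iff[OF meas(1) s] h_le[OF s]
        by (auto simp: tail_def indicator_def split: if_splits intro: less_le_trans)
    qed
    also have "\<dots> \<le> edistr G s" by (rule emeasure_halfline_between_le)
    finally show "edistr tail s \<le> edistr G s" .
  qed (use meas in auto)
  also have "\<dots> \<le> norm_of (\<lambda>x. min (f x) (ennreal a)) + norm_of (\<lambda>x. min (g x) (ennreal b))"
    unfolding G_def using f g by (intro norm_triangle) auto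
  also have "\<dots> \<le> norm_of (outer_part f) + ennreal a * norm_of (indicator {0..1})
        + (norm_of (outer_part g) + ennreal b * norm_of (indicator {0..1}))"
    using f g a b by (intro add_mono norm_min_le_outer) auto
  finally have tail: "norm_of tail \<le> \<dots>" .
  \<comment> \<open>On the gap \<open>(1,2]\<close> not reached by the tail, the rearrangement of
    \<open>h\<close> is at most its value \<open>c\<close> at 1.\<close>
  have "norm_of (outer_part h) \<le> norm_of (\<lambda>t. ennreal c * indicator {1<..2} t + tail t)"
  proof (intro norm_mono plus_Mplus times_Mplus)
    fix t
    have "erearr h t \<le> ennreal c" if "1 < t"
      using erearr_antimono[of 1 t h] that c(2) by (simp add: h_def[abs_def])
    then show "outer_part h t \<le> ennreal c * indicator {1<..2} t + tail t"
      by (auto simp: outer_part_def tail_def split: split_indicator)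
  qed (use meas in auto)
  also have "\<dots> \<le> ennreal c * norm_of (indicator {1<..2}) + norm_of tail"
    using norm_triangle[of "\<lambda>t. ennreal c * indicator {1<..2} t" tail] meas c(1)
    by (simp add: norm_cmult)
  also note tail
  finally show ?thesis by (simp add: h_def[abs_def] add_left_mono)
qed

end

section \<open>The axioms for the Wiener-Luxemburg quasinorm\<close>

locale ri_norm_pair = A: ri_norm A + B: ri_norm B for A B :: fnorm
begin

abbreviation W :: fnorm where "W \<equiv> WL_norm A B"

lemma modulus_invariant: "modulus_invariant W"
  by (simp add: modulus_invariant_def on_nonneg_def WL_norm_def rearrangement_eq)

lemma rearrangement_invariant: "rearrangement_invariant W"
proof -
  have "rearrangement f = rearrangement g" if "equimeasurable f g" for f g
    using that unfolding fun_eq_iff rearrangement_def equimeasurable_def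
    by (intro allI arg_cong[where f = Inf]) auto
  then show ?thesis by (auto simp: rearrangement_invariant_def WL_norm_def)
qed

lemma P2: "axiom_P2 W"
  unfolding axiom_P2_def on_nonneg_WL_norm
proof safe
  fix f g assume "f \<in> Mplus" and g: "g \<in> Mplus" and "AE x in \<lambda>\<^sub>+. f x \<le> g x"
  then have "edistr f s \<le> edistr g s" for s
    by (intro edistr_mono) (auto elim: eventually_mono)
  then have "erearr f t \<le> erearr g t" for t by (intro erearr_mono)
  then show "on_nonneg A (inner_part f) + on_nonneg B (outer_part f)
      \<le> on_nonneg A (inner_part g) + on_nonneg B (outer_part g)"
    by (intro add_mono A.norm_mono B.norm_mono) (auto simp: inner_part_def outer_part_def intro: mult_right_mono)
qed

lemma P3: "axiom_P3 W"
  unfolding axiom_P3_def on_nonneg_WL_norm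
proof (intro allI impI)
  fix F :: "nat \<Rightarrow> real \<Rightarrow> ennreal" and f
  assume "\<forall>n. F n \<in> Mplus" "f \<in> Mplus"
    "AE x in \<lambda>\<^sub>+. incseq (\<lambda>n. F n x) \<and> (\<lambda>n. F n x) \<longlonglongrightarrow> f x"
  then have conv: "incseq (\<lambda>n. erearr (F n) t)" "(\<lambda>n. erearr (F n) t) \<longlonglongrightarrow> erearr f t" for t
    by (auto intro: erearr_monotone_convergence)
  have inner: "incseq (\<lambda>n. inner_part (F n) t)" "(\<lambda>n. inner_part (F n) t) \<longlonglongrightarrow> inner_part f t"
    and outer: "incseq (\<lambda>n. outer_part (F n) t)" "(\<lambda>n. outer_part (F n) t) \<longlonglongrightarrow> outer_part f t" for t
    using conv[of t] by (auto simp: inner_part_def outer_part_def incseq_def split: split_indicator)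
  have incA: "incseq (\<lambda>n. on_nonneg A (inner_part (F n)))"
    and incB: "incseq (\<lambda>n. on_nonneg B (outer_part (F n)))"
    by (intro A.norm_monotone_convergence(1)[OF _ _ inner] B.norm_monotone_convergence(1)[OF _ _ outer]; simp)+
  have "(\<lambda>n. on_nonneg A (inner_part (F n)) + on_nonneg B (outer_part (F n)))
      \<longlonglongrightarrow> on_nonneg A (inner_part f) + on_nonneg B (outer_part f)"
    by (intro tendsto_add A.norm_monotone_convergence(2)[OF _ _ inner] B.norm_monotone_convergence(2)[OF _ _ outer]) auto
  moreover have "incseq (\<lambda>n. on_nonneg A (inner_part (F n)) + on_nonneg B (outer_part (F n)))"
    using incA incB by (auto simp: incseq_def intro: add_mono)
  ultimately show "incseq (\<lambda>n. on_nonneg A (inner_part (F n)) + on_nonneg B (outer_part (F n))) \<and>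
      (\<lambda>n. on_nonneg A (inner_part (F n)) + on_nonneg B (outer_part (F n)))
      \<longlonglongrightarrow> on_nonneg A (inner_part f) + on_nonneg B (outer_part f)" by blast
qed

text \<open>Each piece is at most the full rearrangement, whose norm is that of the indicator
  itself.\<close>

lemma P4: "axiom_P4 W"
  unfolding axiom_P4_def
proof safe
  fix S assume S: "S \<in> sets \<lambda>\<^sub>+" "emeasure \<lambda>\<^sub>+ S < \<infinity>"
  then have ind: "indicator S \<in> Mplus" by (simp add: Mplus_def)
  have "on_nonneg A (inner_part (indicator S)) \<le> on_nonneg A (erearr (indicator S))"
    "on_nonneg B (outer_part (indicator S)) \<le> on_nonneg B (erearr (indicator S))"
    by (intro A.norm_mono B.norm_mono; auto simp: inner_part_def outer_part_def split: split_indicator)+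
  then have "on_nonneg W (indicator S) \<le> on_nonneg A (indicator S) + on_nonneg B (indicator S)"
    by (auto simp: on_nonneg_WL_norm A.norm_erearr B.norm_erearr ind intro: add_mono)
  also have "\<dots> < \<infinity>"
    using A.norm_indicator_finite[OF S] B.norm_indicator_finite[OF S] by simp
  finally show "on_nonneg W (indicator S) < \<infinity>" .
qed

text \<open>Reduces (P5) and the quasi-triangle inequality to finite heights at 1.\<close>

lemma inner_part_infinite:
  assumes "erearr f 1 = \<infinity>"
  shows "on_nonneg A (inner_part f) = \<infinity>"
proof -
  obtain r where "0 < r" "on_nonneg A (indicator {0..1}) = ennreal r"
    by (rule A.norm_unit_interval)
  then show ?thesis
    using A.erearr_1_le_inner[of f] assms by (auto simp: ennreal_top_mult top_unique)
qed

lemma P5: "axiom_P5 W"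
  unfolding axiom_P5_def
proof safe
  fix S assume S: "S \<in> sets \<lambda>\<^sub>+" "emeasure \<lambda>\<^sub>+ S < \<infinity>"
  obtain m where m: "0 \<le> m" "emeasure \<lambda>\<^sub>+ S = ennreal m"
    using S(2) by (cases "emeasure \<lambda>\<^sub>+ S") auto
  obtain K where K: "0 \<le> K"
    "\<And>f. f \<in> Mplus \<Longrightarrow> (\<integral>\<^sup>+x\<in>S. f x \<partial>\<lambda>\<^sub>+) \<le> ennreal K * on_nonneg A f"
    using A.nn_integral_le_norm[OF S] by blast
  obtain r where r: "0 < r" "on_nonneg A (indicator {0..1}) = ennreal r"
    by (rule A.norm_unit_interval)
  \<comment> \<open>\<open>K\<close> pays for the excess over \<open>a\<close> through (P5) of
    \<open>A\<close>, and \<open>m / r\<close> for the constant \<open>a\<close> on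
    \<open>S\<close>. The summand 1 makes \<open>C\<close> positive, so that the bound is infinite
    when the height is.\<close>
  define C where "C = K + m / r + 1"
  have "(\<integral>\<^sup>+x\<in>S. f x \<partial>\<lambda>\<^sub>+) \<le> ennreal C * on_nonneg W f" if f: "f \<in> Mplus" for f
  proof (cases "erearr f 1")
    case (real a)
    have "(\<integral>\<^sup>+x\<in>S. f x \<partial>\<lambda>\<^sub>+) \<le> (\<integral>\<^sup>+x. (f x - ennreal a) * indicator S x + ennreal a * indicator S x \<partial>\<lambda>\<^sub>+)"
      by (intro nn_integral_mono) (auto split: split_indicator intro: ennreal_le_diff_add)
    also have "\<dots> = (\<integral>\<^sup>+x\<in>S. (f x - ennreal a) \<partial>\<lambda>\<^sub>+) + ennreal a * ennreal m"
      using S f m by (subst nn_integral_add) (auto simp: Mplus_def nn_integral_cmult_indicator)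
    also have "\<dots> \<le> ennreal K * on_nonneg A (inner_part f) + ennreal (m / r) * on_nonneg A (inner_part f)"
    proof (rule add_mono)
      have "(\<integral>\<^sup>+x\<in>S. (f x - ennreal a) \<partial>\<lambda>\<^sub>+) \<le> ennreal K * on_nonneg A (\<lambda>x. f x - ennreal a)"
        using f by (intro K(2)) simp
      also have "\<dots> \<le> ennreal K * on_nonneg A (inner_part f)"
        using f real by (intro mult_left_mono A.norm_diff_le_inner) auto
      finally show "(\<integral>\<^sup>+x\<in>S. (f x - ennreal a) \<partial>\<lambda>\<^sub>+) \<le> ennreal K * on_nonneg A (inner_part f)" .
      show "ennreal a * ennreal m \<le> ennreal (m / r) * on_nonneg A (inner_part f)"
        using A.erearr_1_times_le_inner[OF r m(1), of f] real by simp
    qed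
    also have "\<dots> = ennreal (K + m / r) * on_nonneg A (inner_part f)"
      using K(1) m(1) r(1) by (simp add: distrib_right)
    also have "\<dots> \<le> ennreal C * on_nonneg W f"
      unfolding on_nonneg_WL_norm C_def by (intro mult_mono ennreal_leI) auto
    finally show ?thesis .
  next
    case top
    have "0 < C" using K(1) m(1) r(1) by (simp add: C_def add_nonneg_pos)
    then show ?thesis
      using inner_part_infinite[of f] top by (simp add: on_nonneg_WL_norm ennreal_mult_top)
  qed
  moreover have "0 \<le> C" using K(1) m(1) r(1) by (simp add: C_def)
  ultimately show "\<exists>C\<ge>0. \<forall>f\<in>Mplus. (\<integral>\<^sup>+x\<in>S. f x \<partial>\<lambda>\<^sub>+) \<le> ennreal C * on_nonneg W f"
    by blast
qed

lemma definite: "definite W"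
  unfolding definite_def
proof
  fix f assume f: "f \<in> Mplus"
  have "on_nonneg W f = 0 \<longleftrightarrow> (AE t in \<lambda>\<^sub>+. inner_part f t = 0) \<and> (AE t in \<lambda>\<^sub>+. outer_part f t = 0)"
    by (simp add: on_nonneg_WL_norm A.norm_eq_0_iff B.norm_eq_0_iff)
  also have "\<dots> \<longleftrightarrow> (AE t in \<lambda>\<^sub>+. inner_part f t = 0 \<and> outer_part f t = 0)"
    by simp
  also have "\<dots> \<longleftrightarrow> (AE t in \<lambda>\<^sub>+. erearr f t = 0)"
    by (intro AE_cong) (auto simp: inner_part_def outer_part_def space_restrict_space indicator_def)
  \<comment> \<open>Vanishing almost everywhere means \<open>edistr\<close> is zero at level 0, and
    \<open>f\<close> and its rearrangement share that value.\<close>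
  also have "\<dots> \<longleftrightarrow> (AE x in \<lambda>\<^sub>+. f x = 0)"
    using f by (simp add: edistr_erearr flip: edistr_eq_0_iff)
  finally show "on_nonneg W f = 0 \<longleftrightarrow> (AE x in \<lambda>\<^sub>+. f x = 0)" .
qed

lemma pos_homogeneous: "pos_homogeneous W"
  unfolding pos_homogeneous_def
proof (intro allI impI ballI)
  fix a :: real and f assume a: "0 \<le> a" and f: "f \<in> Mplus"
  show "on_nonneg W (\<lambda>x. ennreal a * f x) = ennreal a * on_nonneg W f"
  \<comment> \<open>\<open>erearr_cmult\<close> requires a positive factor; for zero both sides
    vanish by definiteness.\<close>
  proof (cases "a = 0")
    case True
    then show ?thesis using definite by (auto simp: definite_def)
  next
    case False
    with a have "0 < a" by simp
    have "inner_part (\<lambda>x. ennreal a * f x) = (\<lambda>t. ennreal a * inner_part f t)"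
      "outer_part (\<lambda>x. ennreal a * f x) = (\<lambda>t. ennreal a * outer_part f t)"
      by (auto simp: fun_eq_iff inner_part_def outer_part_def erearr_cmult[OF f \<open>0 < a\<close>] mult.assoc)
    then show ?thesis
      using a by (simp add: on_nonneg_WL_norm A.norm_cmult B.norm_cmult distrib_left)
  qed
qed

lemma quasi_triangle:
  obtains C :: real where "1 \<le> C" "\<And>f g. f \<in> Mplus \<Longrightarrow> g \<in> Mplus \<Longrightarrow>
    on_nonneg W (\<lambda>x. f x + g x) \<le> ennreal C * (on_nonneg W f + on_nonneg W g)"
proof -
  obtain r where r: "0 < r" "on_nonneg A (indicator {0..1}) = ennreal r"
    by (rule A.norm_unit_interval)
  obtain p where p: "0 < p" "on_nonneg B (indicator {0..1}) = ennreal p"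
    by (rule B.norm_unit_interval)
  have "emeasure \<lambda>\<^sub>+ {1<..2::real} = 1"
    by (subst emeasure_halfline) auto
  then have "on_nonneg B (indicator {1<..2}) < \<infinity>"
    by (intro B.norm_indicator_finite) (auto simp: sets_restrict_space_iff)
  then obtain q where q: "0 \<le> q" "on_nonneg B (indicator {1<..2}) = ennreal q"
    by (cases "on_nonneg B (indicator {1<..2})") auto
  \<comment> \<open>The 2 comes from the inner estimate; \<open>2 * (q / r)\<close> pays for the
    height of the sum on \<open>(1,2]\<close>, itself bounded by the doubled inner norms;
    \<open>p / r\<close> pays for the heights of \<open>f\<close> and \<open>g\<close> on
    \<open>[0,1]\<close>.\<close>
  define C where "C = 2 + 2 * (q / r) + p / r"
  have C: "1 \<le> C" using r p q by (simp add: C_def)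
  moreover have "on_nonneg W (\<lambda>x. f x + g x) \<le> ennreal C * (on_nonneg W f + on_nonneg W g)"
    if f: "f \<in> Mplus" and g: "g \<in> Mplus" for f g
  proof (cases "on_nonneg A (inner_part f) = \<infinity> \<or> on_nonneg A (inner_part g) = \<infinity>")
    case True
    then show ?thesis using C by (auto simp: on_nonneg_WL_norm ennreal_mult_top)
  next
    case False
    define h where "h x = f x + g x" for x
    define X where "X = on_nonneg A (inner_part f) + on_nonneg A (inner_part g)"
    define Y where "Y = on_nonneg B (outer_part f) + on_nonneg B (outer_part g)"
    have inner: "on_nonneg A (inner_part h) \<le> 2 * X"
      using A.inner_part_add_le[OF f g] by (simp add: h_def[abs_def] X_def)
    \<comment> \<open>Finite inner norms of \<open>f\<close> and \<open>g\<close> give a finite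
      inner norm of \<open>h\<close>, so all three heights at 1 are finite.\<close>
    have "2 * X \<noteq> \<infinity>" using False by (simp add: X_def ennreal_mult_eq_top_iff)
    with inner have "on_nonneg A (inner_part h) \<noteq> \<infinity>" by (auto simp: top_unique)
    with False obtain a b c where
      a: "0 \<le> a" "erearr f 1 = ennreal a" and b: "0 \<le> b" "erearr g 1 = ennreal b"
      and c: "0 \<le> c" "erearr h 1 = ennreal c"
      using inner_part_infinite by (metis ennreal_cases infinity_ennreal_def)
    have c_le: "ennreal c * ennreal q \<le> ennreal (q / r) * (2 * X)"
      using order_trans[OF A.erearr_1_times_le_inner[OF r q(1), of h] mult_left_mono[OF inner]]
      unfolding c(2) by simp
    have ab_le: "ennreal a * ennreal p + ennreal b * ennreal p \<le> ennreal (p / r) * X"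
      using add_mono[OF A.erearr_1_times_le_inner[OF r less_imp_le[OF p(1)], of f]
          A.erearr_1_times_le_inner[OF r less_imp_le[OF p(1)], of g]]
      unfolding a(2) b(2) X_def distrib_left .
    have "on_nonneg B (outer_part h) \<le> ennreal c * ennreal q
      + (on_nonneg B (outer_part f) + ennreal a * ennreal p
        + (on_nonneg B (outer_part g) + ennreal b * ennreal p))"
      using B.outer_part_add_le[OF f g a b c(1)] c(2) by (simp add: h_def[abs_def] p q)
    also have "\<dots> = ennreal c * ennreal q + (ennreal a * ennreal p + ennreal b * ennreal p) + Y"
      by (simp add: Y_def ac_simps)
    also have "\<dots> \<le> ennreal (q / r) * (2 * X) + ennreal (p / r) * X + Y"
      using c_le ab_le by (intro add_mono) auto
    finally have "on_nonneg W h \<le> 2 * X + (ennreal (q / r) * (2 * X) + ennreal (p / r) * X + Y)"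
      using inner unfolding on_nonneg_WL_norm by (intro add_mono)
    \<comment> \<open>All absorbed terms are multiples of \<open>X\<close>; the outer norms enter
      with coefficient 1, which is enlarged to \<open>C\<close> afterwards.\<close>
    also have "\<dots> = ennreal C * X + Y"
    proof -
      have double: "ennreal (2 * u) = 2 * ennreal u" if "0 \<le> u" for u
        using that by (simp add: ennreal_mult)
      have "0 \<le> q / r" "0 \<le> p / r" using r p q by auto
      then have "ennreal C = 2 + 2 * ennreal (q / r) + ennreal (p / r)"
        unfolding C_def by (simp only: double ennreal_plus ennreal_numeral add_nonneg_nonneg
            mult_nonneg_nonneg zero_le_numeral)
      then show ?thesis
        by (simp only: distrib_left distrib_right ac_simps)
    qed
    also have "\<dots> \<le> ennreal C * X + ennreal C * Y"
    proof (rule add_left_mono)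
      have "1 \<le> ennreal C" using C by simp
      then have "1 * Y \<le> ennreal C * Y" by (rule mult_right_mono) simp
      then show "Y \<le> ennreal C * Y" by (simp only: mult_1)
    qed
    also have "\<dots> = ennreal C * (on_nonneg W f + on_nonneg W g)"
      by (simp only: on_nonneg_WL_norm X_def Y_def distrib_left ac_simps)
    finally show ?thesis by (simp add: h_def[abs_def])
  qed
  ultimately show ?thesis by (rule that)
qed

lemma quasi_banach: "quasi_banach_function_norm W"
  unfolding quasi_banach_function_norm_def axiom_Q1_def
  using modulus_invariant pos_homogeneous definite P2 P3 P4 quasi_triangle by metis

end

theorem theorem3p4:
  fixes A B :: fnorm
  assumes "banach_function_norm A" and "rearrangement_invariant A"
    and "banach_function_norm B" and "rearrangement_invariant B"
  shows "quasi_banach_function_norm (WL_norm A B) \<and> rearrangement_invariant (WL_norm A B) \<and>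
         axiom_P5 (WL_norm A B) \<and>
         ri_quasi_banach_function_space (WL_space A B) (WL_norm A B)"
proof -
  interpret ri_norm_pair A B
    using assms by unfold_locales
  show ?thesis
    using quasi_banach rearrangement_invariant P5
    by (simp add: ri_quasi_banach_function_space_def WL_space_def)
qed

end
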